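(* Let $n\ge 1$ be an integer. The self-maps $\tau:S_n\to S_n$, $\theta\mapsto \tau_\theta$, of the symmetric group satisfying $$\forall\,\theta\in S_n\ \ \forall\ \text{c-simple transposition }\sigma\in S_n:\quad \tau_{\theta\sigma}\in\{\tau_\theta,\ (\theta\sigma\theta^{-1})\cdot\tau_\theta\}$$ are precisely the constant maps and the right translations.
   Context: $S_n$ is the group of permutations of $\{1,\dots,n\}$. The c-simple transpositions in $S_n$ are $(1\ 2),\ (2\ 3),\ \dots,\ (n-1\ n),\ (n\ 1)$ (there are none when $n=1$). A right translation of a group $G$ is a map of the form $x\mapsto xg$ for a fixed $g\in G$. *)

theory Defs
  imports "HOL-Algebra.Sym_Groups"
begin

text \<open>
  The case \<open>n = 1\<close> has to be cut out of the wrap-around transposition \<open>(n 1)\<close>, since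
  \<^term>\<open>transpose 1 1\<close> is the identity.  For \<open>n = 2\<close> the two clauses give the same permutation.
\<close>

definition c_simple_transpositions :: "nat \<Rightarrow> (nat \<Rightarrow> nat) set"
  where "c_simple_transpositions n =
    {transpose i (i + 1) | i. 1 \<le> i \<and> i < n} \<union> (if n \<ge> 2 then {transpose n 1} else {})"

text \<open>
  Functions in HOL are total, so a self-map of \<open>G\<close> is only looked at on \<^term>\<open>carrier G\<close>.
\<close>

definition constant_self_map :: "('a, 'b) monoid_scheme \<Rightarrow> ('a \<Rightarrow> 'a) \<Rightarrow> bool"
  where "constant_self_map G f \<longleftrightarrow> (\<exists>c\<in>carrier G. \<forall>x\<in>carrier G. f x = c)"

definition right_translation :: "('a, 'b) monoid_scheme \<Rightarrow> ('a \<Rightarrow> 'a) \<Rightarrow> bool"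
  where "right_translation G f \<longleftrightarrow> (\<exists>g\<in>carrier G. \<forall>x\<in>carrier G. f x = x \<otimes>\<^bsub>G\<^esub> g)"

end

theory Submission
  imports Defs
begin

text \<open>
  Call an edge \<open>(\<theta>, \<theta>\<sigma>)\<close> of the Cayley graph fixed if \<open>\<tau>\<close> takes the same value at both ends.
  The positions \<open>1, \<dots>, n\<close> form a cycle, and if the edge at \<open>\<theta>\<close> that exchanges
  the positions \<open>p, p + 1\<close> is fixed, then so is the one exchanging \<open>p + 1, p + 2\<close>: otherwise let
  \<open>b, a, x\<close> be the entries of \<open>\<theta>\<close> at \<open>p, p + 1, p + 2\<close>, and walk \<open>a\<close> from \<open>\<theta>\<close>, respectively \<open>b\<close>
  from \<open>\<theta>\<sigma>\<close>, forward around the cycle to the position \<open>p - 1\<close>.  Let \<open>c\<close> be the point with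
  \<open>\<tau>\<^sub>\<theta>(c) = a\<close>.  The image of \<open>c\<close> becomes \<open>x\<close> in the first step of the first walk and stays \<open>x\<close>;
  on the second walk it stays \<open>a\<close>.  But the walks end in
  adjacent permutations, whose values under \<open>\<tau>\<close> differ at most by \<open>(a b)\<close>, a contradiction.
  Hence the edges at a vertex, and then all edges, are fixed or not fixed simultaneously.  In
  the first case \<open>\<tau>\<close> is constant, in the second \<open>\<theta>\<^sup>-\<^sup>1\<tau>\<^sub>\<theta>\<close> is constant.
\<close>

section \<open>Functions invariant under adjacent transpositions\<close>

text \<open>A transposition is conjugate, by an adjacent one, to a transposition of two closer
  points. Induction on the distance thus gives invariance under all transpositions, and these
  generate the group.\<close>

lemma permutes_invariant_adjacent_transpositions:
  fixes f :: "(nat \<Rightarrow> nat) \<Rightarrow> 'a"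
  assumes step: "\<And>\<theta> i. \<lbrakk>\<theta> permutes {1..n}; 1 \<le> i; i < n\<rbrakk> \<Longrightarrow> f (\<theta> \<circ> transpose i (i + 1)) = f \<theta>"
    and "\<theta> permutes {1..n}"
  shows "f \<theta> = f id"
proof -
  have less_case: "f (\<theta> \<circ> transpose i (Suc (i + d))) = f \<theta>"
    if "\<theta> permutes {1..n}" "1 \<le> i" "Suc (i + d) \<le> n" for \<theta> i d
    using that
  proof (induction d arbitrary: \<theta>)
    case 0
    then show ?case using step[of \<theta> i] by (simp add: o_def)
  next
    case (Suc d)
    let ?s = "transpose (Suc (i + d)) (Suc (i + d) + 1)" and ?t = "transpose i (Suc (i + d))"
    have s: "?s permutes {1..n}" and t: "?t permutes {1..n}"
      using Suc.prems by (auto intro!: permutes_swap_id)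
    have eq: "transpose i (Suc (i + Suc d)) = ?s \<circ> ?t \<circ> ?s"
      using transpose_comp_triple[of "Suc (i + Suc d)" i "Suc (i + d)"]
      by (simp add: transpose_def fun_eq_iff)
    have "f (\<theta> \<circ> ?s \<circ> ?t \<circ> ?s) = f (\<theta> \<circ> ?s \<circ> ?t)"
      using Suc.prems s t by (intro step permutes_compose) auto
    also have "\<dots> = f (\<theta> \<circ> ?s)"
      using Suc.prems s by (intro Suc.IH permutes_compose) auto
    also have "\<dots> = f \<theta>"
      using Suc.prems by (intro step) auto
    finally show ?case
      by (simp only: eq comp_assoc)
  qed
  have any: "f (\<theta> \<circ> transpose i j) = f \<theta>"
    if "\<theta> permutes {1..n}" "i \<in> {1..n}" "j \<in> {1..n}" for \<theta> i j
  proof (cases i j rule: linorder_cases)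
    case less
    then show ?thesis
      using that less_case[of \<theta> i "j - i - 1"] by simp
  next
    case greater
    then show ?thesis
      using that less_case[of \<theta> j "i - j - 1"] by (simp add: transpose_commute)
  qed simp
  have "\<theta> permutes {1..n} \<and> f \<theta> = f id"
    using finite_atLeastAtMost \<open>\<theta> permutes {1..n}\<close>
  proof (induction rule: permutes_rev_induct)
    case (swap a b p)
    then show ?case
      using any[of p a b] permutes_compose[OF permutes_swap_id[of a "{1..n}" b], of p] by metis
  qed (rule conjI[OF permutes_id refl])
  then show ?thesis ..
qed

section \<open>Positions on a cycle\<close>

text \<open>Indices are read modulo \<open>n\<close> and start at 0, so index 0 is position 1 and a
  successor at position \<open>n\<close> wraps around without a case distinction.\<close>

definition cyclic_pos :: "nat \<Rightarrow> nat \<Rightarrow> nat"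
  where "cyclic_pos n k = k mod n + 1"

lemma cyclic_pos_in: "n \<ge> 1 \<Longrightarrow> cyclic_pos n k \<in> {1..n}"
  by (simp add: cyclic_pos_def Suc_le_eq)

lemma cyclic_pos_add_eq_iff:
  assumes "j < n" "k < n"
  shows "cyclic_pos n (s + j) = cyclic_pos n (s + k) \<longleftrightarrow> j = k"
proof -
  have "(s + i) mod n \<noteq> (s + i') mod n" if "i < i'" "i' < n" for i i'
  proof
    assume "(s + i) mod n = (s + i') mod n"
    then have "n dvd (s + i') - (s + i)"
      using that by (intro mod_eq_dvd_iff_nat[THEN iffD1]) auto
    then show False
      using that by (auto dest: dvd_imp_le)
  qed
  then have "j = k" if "(s + j) mod n = (s + k) mod n"
    using that assms by (metis linorder_neqE_nat)
  then show ?thesis by (auto simp: cyclic_pos_def)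
qed

text \<open>This makes the rotational symmetry visible: the wrap-around transposition is the one
  with index \<open>n - 1\<close>. For \<open>n = 1\<close> the range would be the identity alone,
  while there are no c-simple transpositions.\<close>

lemma c_simple_transpositions_eq_cyclic:
  assumes "n \<ge> 2"
  shows "c_simple_transpositions n = range (\<lambda>k. transpose (cyclic_pos n k) (cyclic_pos n (k + 1)))"
    (is "_ = range ?s")
proof (intro equalityI subsetI)
  fix \<sigma> assume "\<sigma> \<in> c_simple_transpositions n"
  then consider i where "1 \<le> i" "i < n" "\<sigma> = transpose i (i + 1)" | "\<sigma> = transpose n 1"
    using assms by (auto simp: c_simple_transpositions_def)
  then show "\<sigma> \<in> range ?s"
  proof cases
    case 1
    then have "\<sigma> = ?s (i - 1)" by (simp add: cyclic_pos_def)
    then show ?thesis by blast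
  next
    case 2
    then have "\<sigma> = ?s (n - 1)" using assms by (simp add: cyclic_pos_def)
    then show ?thesis by blast
  qed
next
  fix \<sigma> assume "\<sigma> \<in> range ?s"
  then obtain k where k: "\<sigma> = ?s k" by blast
  show "\<sigma> \<in> c_simple_transpositions n"
  proof (cases "Suc (k mod n) = n")
    case True
    then have "Suc k mod n = 0" by (simp add: mod_Suc)
    then have "\<sigma> = transpose n 1" using True by (simp add: k cyclic_pos_def)
    then show ?thesis using assms by (simp add: c_simple_transpositions_def)
  next
    case False
    moreover have "k mod n < n" using assms by simp
    ultimately have "\<sigma> = transpose (k mod n + 1) (k mod n + 1 + 1)" "k mod n + 1 < n"
      by (auto simp: k cyclic_pos_def mod_Suc)
    then show ?thesis by (auto simp: c_simple_transpositions_def)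
  qed
qed

lemma c_simple_transpositions_permutes:
  assumes "\<sigma> \<in> c_simple_transpositions n"
  shows "\<sigma> permutes {1..n}"
  using assms by (auto simp: c_simple_transpositions_def intro!: permutes_swap_id split: if_splits)

text \<open>Conjugation turns an exchange of positions into the exchange of the entries of \<theta>
  standing there; this is how the factor in the hypothesis on \<tau> is read from now on.\<close>

lemma permutes_conj_transpose:
  assumes "\<theta> permutes S"
  shows "\<theta> \<circ> transpose i j \<circ> inv' \<theta> = transpose (\<theta> i) (\<theta> j)"
  using transpose_comp_eq[OF permutes_bij[OF assms], of "\<theta> i" "\<theta> j"]
  by (metis assms comp_assoc comp_id permutes_inverses(2) permutes_inv_o(1))

section \<open>Fixed edges of the Cayley graph\<close>

locale reflecting_self_map =
  fixes n :: nat and \<tau> :: "(nat \<Rightarrow> nat) \<Rightarrow> (nat \<Rightarrow> nat)"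
  assumes two_le: "n \<ge> 2"
    and permutes_\<tau>: "\<theta> permutes {1..n} \<Longrightarrow> \<tau> \<theta> permutes {1..n}"
    and \<tau>_c_simple: "\<lbrakk>\<theta> permutes {1..n}; \<sigma> \<in> c_simple_transpositions n\<rbrakk>
      \<Longrightarrow> \<tau> (\<theta> \<circ> \<sigma>) \<in> {\<tau> \<theta>, \<theta> \<circ> \<sigma> \<circ> inv' \<theta> \<circ> \<tau> \<theta>}"
begin

abbreviation pos :: "nat \<Rightarrow> nat"
  where "pos \<equiv> cyclic_pos n"

abbreviation swap :: "nat \<Rightarrow> nat \<Rightarrow> nat"
  where "swap k \<equiv> transpose (pos k) (pos (k + 1))"

lemma swap_c_simple: "swap k \<in> c_simple_transpositions n"
  by (simp add: c_simple_transpositions_eq_cyclic[OF two_le])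

lemma pos_in: "pos k \<in> {1..n}"
  using two_le by (intro cyclic_pos_in) simp

lemma permutes_comp_transpose_pos:
  "\<theta> permutes {1..n} \<Longrightarrow> \<theta> \<circ> transpose (pos j) (pos k) permutes {1..n}"
  by (intro permutes_compose permutes_swap_id pos_in)

lemma \<tau>_swap_cases:
  assumes "\<theta> permutes {1..n}"
  obtains "\<tau> (\<theta> \<circ> swap k) = \<tau> \<theta>"
    | "\<tau> (\<theta> \<circ> swap k) = transpose (\<theta> (pos k)) (\<theta> (pos (k + 1))) \<circ> \<tau> \<theta>"
proof -
  show thesis
    using \<tau>_c_simple[OF assms swap_c_simple[of k]] that
    unfolding permutes_conj_transpose[OF assms] by auto
qed

text \<open>In either case for the edge, only the two exchanged entries can move. This tracks the
  image of one point along a walk.\<close>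

lemma \<tau>_swap_apply_eq:
  assumes "\<theta> permutes {1..n}" "\<tau> \<theta> c = y" "y \<noteq> \<theta> (pos k)" "y \<noteq> \<theta> (pos (k + 1))"
  shows "\<tau> (\<theta> \<circ> swap k) c = y"
  by (rule \<tau>_swap_cases[OF assms(1), of k]) (use assms in auto)

lemma fixed_swap_Suc:
  assumes "n \<ge> 3" and \<theta>: "\<theta> permutes {1..n}" and fixed: "\<tau> (\<theta> \<circ> swap s) = \<tau> \<theta>"
  shows "\<tau> (\<theta> \<circ> swap (s + 1)) = \<tau> \<theta>"
proof (rule ccontr)
  assume moved: "\<tau> (\<theta> \<circ> swap (s + 1)) \<noteq> \<tau> \<theta>"
  \<comment> \<open>Positions are renumbered from the start of the fixed swap, so that \<theta>
    begins with \<open>b, a, x\<close>, and \<open>q (n - 1)\<close> is the position just before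
    \<open>q 0\<close> on the cycle.\<close>
  define q where "q j = pos (s + j)" for j
  define a b x where "a = \<theta> (q 1)" and "b = \<theta> (q 0)" and "x = \<theta> (q 2)"
  have q_eq: "q j = q k \<longleftrightarrow> j = k" if "j < n" "k < n" for j k
    using that by (simp add: q_def cyclic_pos_add_eq_iff)
  have u_eq: "u (q j) = u (q k) \<longleftrightarrow> j = k" if "u permutes {1..n}" "j < n" "k < n" for u j k
    using that permutes_inj[of u] by (auto simp: inj_eq q_eq)
  have swap_q: "swap (s + j) = transpose (q j) (q (Suc j))" for j
    by (simp add: q_def)
  have ab: "a \<noteq> b" and xa: "x \<noteq> a" and xb: "x \<noteq> b"
    using \<open>n \<ge> 3\<close> u_eq[OF \<theta>] by (auto simp: a_def b_def x_def)
  obtain c where c: "\<tau> \<theta> c = a"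
    using permutes_surj[OF permutes_\<tau>[OF \<theta>]] by (metis surjD)
  \<comment> \<open>Both walks are followed at once: \<open>u\<close> is the first walk when
    \<open>a\<close> has reached \<open>q j\<close>, and the second walk is then at \<open>u\<close>
    with \<open>a\<close> and \<open>b\<close> exchanged. Recording that \<open>x\<close> stays at
    \<open>q 1\<close> ensures that later steps do not meet it.\<close>
  have walk: "\<exists>u. u permutes {1..n} \<and> u (q 0) = b \<and> u (q j) = a \<and> u (q 1) = x \<and>
      \<tau> u c = x \<and> \<tau> (u \<circ> transpose (q 0) (q j)) c = a" if "2 \<le> j" "j < n" for j
    using that
  proof (induction j rule: dec_induct)
    case base
    let ?u = "\<theta> \<circ> swap (s + 1)" and ?v = "\<theta> \<circ> swap s"
    have u: "?u permutes {1..n}" and v: "?v permutes {1..n}"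
      using \<theta> by (rule permutes_comp_transpose_pos)+
    have neq: "q 0 \<noteq> q 1" "q 0 \<noteq> q 2" "q 1 \<noteq> q 2"
      using \<open>n \<ge> 3\<close> by (simp_all add: q_eq)
    have "\<tau> ?u = transpose a x \<circ> \<tau> \<theta>"
      using moved by (rule_tac \<tau>_swap_cases[OF \<theta>, of "s + 1"])
        (auto simp: a_def x_def q_def numeral_2_eq_2)
    then have "\<tau> ?u c = x" by (simp add: c)
    moreover have "\<tau> (?v \<circ> swap (s + 1)) c = a"
    proof (rule \<tau>_swap_apply_eq[OF v])
      show "\<tau> ?v c = a" using fixed c by simp
      have "?v (q 1) = b" "?v (q 2) = x"
        using neq swap_q[of 0] by (auto simp: b_def x_def)
      then show "a \<noteq> ?v (pos (s + 1))" "a \<noteq> ?v (pos (s + 1 + 1))"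
        using ab xa by (auto simp: q_def numeral_2_eq_2)
    qed
    moreover have "?v \<circ> swap (s + 1) = ?u \<circ> transpose (q 0) (q 2)"
      using neq swap_q[of 0] swap_q[of 1]
      by (auto simp: fun_eq_iff transpose_def numeral_2_eq_2)
    moreover have "?u (q 0) = b" "?u (q 2) = a" "?u (q 1) = x"
      using neq swap_q[of 1] by (auto simp: a_def b_def x_def numeral_2_eq_2)
    ultimately show ?case using u by metis
  next
    case (step j)
    then obtain u where u: "u permutes {1..n}" "u (q 0) = b" "u (q j) = a" "u (q 1) = x"
        "\<tau> u c = x" "\<tau> (u \<circ> transpose (q 0) (q j)) c = a"
      using Suc_lessD by blast
    let ?u = "u \<circ> swap (s + j)" and ?v = "u \<circ> transpose (q 0) (q j)"
    have v: "?v permutes {1..n}"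
      unfolding q_def using u(1) by (rule permutes_comp_transpose_pos)
    have neq: "q 0 \<noteq> q j" "q 0 \<noteq> q (Suc j)" "q j \<noteq> q (Suc j)" "q 1 \<noteq> q j" "q 1 \<noteq> q (Suc j)"
      using step by (simp_all add: q_eq)
    \<comment> \<open>The first walk exchanges \<open>a\<close> with the entry at
      \<open>q (Suc j)\<close>, which is not \<open>x\<close>; the second exchanges \<open>b\<close>
      with that same entry, which is not \<open>a\<close>.\<close>
    have "\<tau> ?u c = x"
    proof (rule \<tau>_swap_apply_eq[OF u(1,5)])
      show "x \<noteq> u (pos (s + j))" "x \<noteq> u (pos (s + j + 1))"
        using step u_eq[OF u(1), of 1 "Suc j"] u xa by (auto simp: q_def)
    qed
    moreover have "\<tau> (?v \<circ> swap (s + j)) c = a"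
    proof (rule \<tau>_swap_apply_eq[OF v u(6)])
      have "?v (q j) = b" "?v (q (Suc j)) = u (q (Suc j))"
        using neq u by auto
      moreover have "u (q (Suc j)) \<noteq> a"
        using step u_eq[OF u(1), of "Suc j" j] u by auto
      ultimately show "a \<noteq> ?v (pos (s + j))" "a \<noteq> ?v (pos (s + j + 1))"
        using ab by (auto simp: q_def)
    qed
    moreover have "?v \<circ> swap (s + j) = ?u \<circ> transpose (q 0) (q (Suc j))"
      using neq unfolding swap_q by (auto simp: fun_eq_iff transpose_def)
    moreover have "?u permutes {1..n}"
      using u(1) by (rule permutes_comp_transpose_pos)
    moreover have "?u (q 0) = b" "?u (q (Suc j)) = a" "?u (q 1) = x"
      using neq u unfolding swap_q by auto
    ultimately show ?case by metis
  qed
  have "2 \<le> n - 1" "n - 1 < n"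
    using \<open>n \<ge> 3\<close> by simp_all
  from walk[OF this] obtain u where u: "u permutes {1..n}" "u (q 0) = b" "u (q (n - 1)) = a"
      "\<tau> u c = x" "\<tau> (u \<circ> transpose (q 0) (q (n - 1))) c = a"
    by blast
  \<comment> \<open>The cycle closes: the swap after \<open>q (n - 1)\<close> exchanges
    \<open>a\<close> and \<open>b\<close> and joins the ends of the two walks. As \<open>x\<close>
    is neither entry, it would have to survive, yet the other end has \<open>a\<close>.\<close>
  have q0: "q 0 = pos (s + (n - 1) + 1)"
    using \<open>n \<ge> 3\<close> by (simp add: q_def cyclic_pos_def)
  have "\<tau> (u \<circ> swap (s + (n - 1))) c = x"
    using u xa xb q0 by (intro \<tau>_swap_apply_eq) (auto simp: q_def)
  moreover have "swap (s + (n - 1)) = transpose (q 0) (q (n - 1))"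
    unfolding q0 by (simp add: q_def transpose_commute)
  ultimately show False using u xa by simp
qed

text \<open>Being fixed propagates forward from one position to the next, hence around the whole
  cycle. For \<open>n = 2\<close> there is only one swap.\<close>

lemma fixed_swap_all:
  assumes "\<theta> permutes {1..n}" "\<tau> (\<theta> \<circ> swap s) = \<tau> \<theta>"
  shows "\<tau> (\<theta> \<circ> swap k) = \<tau> \<theta>"
proof (cases "n = 2")
  case True
  then have "swap k = transpose 1 2" for k
    using swap_c_simple[of k] by (auto simp: c_simple_transpositions_def transpose_commute
        numeral_2_eq_2 less_Suc_eq_le dest: le_antisym)
  then show ?thesis using assms by simp
next
  case False
  with two_le have "n \<ge> 3" by simp
  have "\<tau> (\<theta> \<circ> swap (s + d)) = \<tau> \<theta>" for d
  proof (induction d)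
    case (Suc d)
    then show ?case
      using fixed_swap_Suc[OF \<open>n \<ge> 3\<close> assms(1), of "s + d"] by (simp add: o_def)
  qed (use assms in \<open>simp add: o_def\<close>)
  \<comment> \<open>Only forward steps from \<open>s\<close> are available, so \<open>k\<close> is
    reached through an index congruent to it and at least \<open>s\<close>.\<close>
  from this[of "s * (n - 1) + k"] have "\<tau> (\<theta> \<circ> swap (s * n + k)) = \<tau> \<theta>"
    using two_le by (cases n) (auto simp: algebra_simps)
  moreover have "swap (s * n + k) = swap k"
    unfolding cyclic_pos_def by (metis add.assoc mod_mult_self3)
  ultimately show ?thesis by simp
qed

text \<open>Passes from edges to the whole group; it serves below for \<open>fixed\<close>, for
  \<tau>, and for \<open>inv' \<theta> \<circ> \<tau> \<theta>\<close>.\<close>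

lemma invariant_swap_imp_eq_id:
  assumes "\<And>\<theta> k. \<theta> permutes {1..n} \<Longrightarrow> f (\<theta> \<circ> swap k) = f \<theta>" "\<theta> permutes {1..n}"
  shows "f \<theta> = f id"
proof (rule permutes_invariant_adjacent_transpositions[OF _ assms(2)])
  fix \<theta> i assume "\<theta> permutes {1..n}" "1 \<le> i" "i < n"
  moreover have "transpose i (i + 1) = swap (i - 1)"
    using \<open>1 \<le> i\<close> \<open>i < n\<close> by (simp add: cyclic_pos_def)
  ultimately show "f (\<theta> \<circ> transpose i (i + 1)) = f \<theta>"
    using assms(1)[of \<theta> "i - 1"] by metis
qed

lemma constant_or_translation:
  "(\<forall>\<theta>. \<theta> permutes {1..n} \<longrightarrow> \<tau> \<theta> = \<tau> id) \<or> (\<forall>\<theta>. \<theta> permutes {1..n} \<longrightarrow> \<tau> \<theta> = \<theta> \<circ> \<tau> id)"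
proof -
  define fixed where "fixed \<theta> \<longleftrightarrow> (\<forall>k. \<tau> (\<theta> \<circ> swap k) = \<tau> \<theta>)" for \<theta>
  have fixed_swap: "fixed (\<theta> \<circ> swap k)" if "\<theta> permutes {1..n}" "fixed \<theta>" for \<theta> k
  proof -
    \<comment> \<open>This is the same edge seen from its other end; one fixed edge there makes all
      edges there fixed.\<close>
    have "\<tau> (\<theta> \<circ> swap k \<circ> swap k) = \<tau> (\<theta> \<circ> swap k)"
      using that by (simp add: fixed_def comp_assoc)
    then show ?thesis
      using fixed_swap_all permutes_comp_transpose_pos[OF that(1)] unfolding fixed_def by blast
  qed
  have fixed_eq: "fixed \<theta> = fixed id" if "\<theta> permutes {1..n}" for \<theta>
  proof (rule invariant_swap_imp_eq_id[OF _ that])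
    fix \<theta> k assume \<theta>: "\<theta> permutes {1..n}"
    show "fixed (\<theta> \<circ> swap k) = fixed \<theta>"
      using fixed_swap[OF \<theta>, of k] fixed_swap[OF permutes_comp_transpose_pos[OF \<theta>], of k "k + 1" k]
      unfolding comp_assoc transpose_comp_involutory comp_id by blast
  qed
  show ?thesis
  proof (cases "fixed id")
    case True
    then have "\<tau> (\<theta> \<circ> swap k) = \<tau> \<theta>" if "\<theta> permutes {1..n}" for \<theta> k
      using fixed_eq[OF that] by (simp add: fixed_def)
    then have "\<tau> \<theta> = \<tau> id" if "\<theta> permutes {1..n}" for \<theta>
      by (rule invariant_swap_imp_eq_id[OF _ that])
    then show ?thesis by blast
  next
    case False
    \<comment> \<open>Now no edge is fixed, so every edge multiplies \<tau> on the left by the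
      conjugate of its swap. The inverse of the new vertex contributes the swap once more, and the
      two cancel.\<close>
    have "inv' \<theta> \<circ> \<tau> \<theta> = inv' id \<circ> \<tau> id" if "\<theta> permutes {1..n}" for \<theta>
    proof (rule invariant_swap_imp_eq_id[OF _ that])
      fix \<theta> k assume \<theta>: "\<theta> permutes {1..n}"
      have "\<not> fixed \<theta>" using False fixed_eq[OF \<theta>] by simp
      then have "\<tau> (\<theta> \<circ> swap k) \<noteq> \<tau> \<theta>"
        using fixed_swap_all[OF \<theta>] by (auto simp: fixed_def)
      then have "\<tau> (\<theta> \<circ> swap k) = transpose (\<theta> (pos k)) (\<theta> (pos (k + 1))) \<circ> \<tau> \<theta>"
        by (rule_tac \<tau>_swap_cases[OF \<theta>, of k]) auto
      moreover have "inv' (\<theta> \<circ> swap k) = swap k \<circ> inv' \<theta>"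
        using permutes_bij[OF \<theta>] by (simp add: o_inv_distrib)
      ultimately have "inv' (\<theta> \<circ> swap k) \<circ> \<tau> (\<theta> \<circ> swap k)
          = swap k \<circ> (inv' \<theta> \<circ> \<theta>) \<circ> swap k \<circ> inv' \<theta> \<circ> \<tau> \<theta>"
        by (simp only: permutes_conj_transpose[OF \<theta>, symmetric] comp_assoc)
      also have "\<dots> = inv' \<theta> \<circ> \<tau> \<theta>"
        by (simp only: permutes_inv_o(2)[OF \<theta>] comp_id transpose_comp_involutory id_comp)
      finally show "inv' (\<theta> \<circ> swap k) \<circ> \<tau> (\<theta> \<circ> swap k) = inv' \<theta> \<circ> \<tau> \<theta>" .
    qed
    then have "\<tau> \<theta> = \<theta> \<circ> \<tau> id" if "\<theta> permutes {1..n}" for \<theta>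
      using permutes_inv_o(1)[OF that] by (metis comp_assoc id_comp inv_id that)
    then show ?thesis by blast
  qed
qed

end

section \<open>Classification of the self-maps\<close>

theorem proposition1p4:
  fixes n :: nat and \<tau> :: "(nat \<Rightarrow> nat) \<Rightarrow> (nat \<Rightarrow> nat)"
  assumes "n \<ge> 1"
    and "\<tau> \<in> carrier (sym_group n) \<rightarrow> carrier (sym_group n)"
  shows "(\<forall>\<theta>\<in>carrier (sym_group n). \<forall>\<sigma>\<in>c_simple_transpositions n.
            \<tau> (\<theta> \<otimes>\<^bsub>sym_group n\<^esub> \<sigma>) \<in>
              {\<tau> \<theta>,
               (\<theta> \<otimes>\<^bsub>sym_group n\<^esub> \<sigma> \<otimes>\<^bsub>sym_group n\<^esub> inv\<^bsub>sym_group n\<^esub> \<theta>)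
                 \<otimes>\<^bsub>sym_group n\<^esub> \<tau> \<theta>})
         \<longleftrightarrow> constant_self_map (sym_group n) \<tau> \<or> right_translation (sym_group n) \<tau>"
    (is "?L \<longleftrightarrow> ?R")
proof
  assume L: ?L
  have \<tau>: "\<tau> \<theta> permutes {1..n}" if "\<theta> permutes {1..n}" for \<theta>
    using assms(2) that by (auto simp: sym_group_carrier Pi_iff)
  have "(\<forall>\<theta>. \<theta> permutes {1..n} \<longrightarrow> \<tau> \<theta> = \<tau> id) \<or>
      (\<forall>\<theta>. \<theta> permutes {1..n} \<longrightarrow> \<tau> \<theta> = \<theta> \<circ> \<tau> id)"
  proof (cases "n = 1")
    case True
    then have "\<theta> = id" if "\<theta> permutes {1..n}" for \<theta>
      using that by simp
    then show ?thesis by blast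
  next
    case False
    interpret reflecting_self_map n \<tau>
    proof
      show "n \<ge> 2" using False assms(1) by simp
    next
      fix \<theta> \<sigma> assume "\<theta> permutes {1..n}" "\<sigma> \<in> c_simple_transpositions n"
      moreover from this(1) have "inv\<^bsub>sym_group n\<^esub> \<theta> = inv' \<theta>"
        by (simp add: sym_group_carrier)
      ultimately show "\<tau> (\<theta> \<circ> \<sigma>) \<in> {\<tau> \<theta>, \<theta> \<circ> \<sigma> \<circ> inv' \<theta> \<circ> \<tau> \<theta>}"
        using L by (simp add: sym_group_carrier sym_group_mult)
    qed (rule \<tau>)
    show ?thesis by (rule constant_or_translation)
  qed
  then show ?R
  proof
    assume "\<forall>\<theta>. \<theta> permutes {1..n} \<longrightarrow> \<tau> \<theta> = \<tau> id"
    then have "constant_self_map (sym_group n) \<tau>"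
      unfolding constant_self_map_def Ball_def
      by (intro bexI[of _ "\<tau> id"]) (simp_all only: sym_group_carrier \<tau>[OF permutes_id])
    then show ?thesis ..
  next
    assume "\<forall>\<theta>. \<theta> permutes {1..n} \<longrightarrow> \<tau> \<theta> = \<theta> \<circ> \<tau> id"
    then have "right_translation (sym_group n) \<tau>"
      unfolding right_translation_def Ball_def sym_group_mult
      by (intro bexI[of _ "\<tau> id"]) (simp_all only: sym_group_carrier \<tau>[OF permutes_id])
    then show ?thesis ..
  qed
next
  interpret group "sym_group n" by (rule sym_group_is_group)
  assume R: ?R
  show ?L
  proof (intro ballI)
    fix \<theta> \<sigma> assume \<theta>: "\<theta> \<in> carrier (sym_group n)" and "\<sigma> \<in> c_simple_transpositions n"
    then have \<sigma>: "\<sigma> \<in> carrier (sym_group n)"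
      unfolding sym_group_carrier by (intro c_simple_transpositions_permutes)
    from R show "\<tau> (\<theta> \<otimes>\<^bsub>sym_group n\<^esub> \<sigma>) \<in> {\<tau> \<theta>,
        (\<theta> \<otimes>\<^bsub>sym_group n\<^esub> \<sigma> \<otimes>\<^bsub>sym_group n\<^esub> inv\<^bsub>sym_group n\<^esub> \<theta>) \<otimes>\<^bsub>sym_group n\<^esub> \<tau> \<theta>}"
    proof
      assume "constant_self_map (sym_group n) \<tau>"
      then show ?thesis using \<theta> \<sigma> by (auto simp: constant_self_map_def)
    next
      assume "right_translation (sym_group n) \<tau>"
      then obtain g where g: "g \<in> carrier (sym_group n)"
        and \<tau>: "\<And>x. x \<in> carrier (sym_group n) \<Longrightarrow> \<tau> x = x \<otimes>\<^bsub>sym_group n\<^esub> g"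
        by (auto simp: right_translation_def)
      \<comment> \<open>This cancellation shows that a right translation always takes the second
        alternative, just as a constant map takes the first.\<close>
      have "inv\<^bsub>sym_group n\<^esub> \<theta> \<otimes>\<^bsub>sym_group n\<^esub> (\<theta> \<otimes>\<^bsub>sym_group n\<^esub> g) = g"
        using \<theta> g by (metis inv_closed l_inv l_one m_assoc)
      then show ?thesis
        using \<theta> \<sigma> g by (simp add: \<tau> m_assoc del: sym_group_inv_equality)
    qed
  qed
qed

end
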